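(* Let $\mathcal F=\text{C-RASP}^1$ with complexity measure $\mathcal C(f)=\max(|a|,|b|,|d|)$. Then for all $T\in\mathbb N$, $N_{\mathcal A_{\mathrm{mci}}}(T)\le O(T^2)$; i.e. there is an absolute constant $C_0>0$ such that $N_{\mathcal A_{\mathrm{mci}}}(T)\le C_0T^2$ for all $T\ge 1$. That is, the Minimum-Complexity Interpolator with complexity $\mathcal C$ and function class $\mathcal F$ length generalizes given inputs of length $O(T^2)$ when the ground-truth function has complexity $T$.
   Context: For $x\in\{0,1\}^n$ write $\mathrm{ps}(x)_j=\sum_{l=1}^j x_l$. $\text{C-RASP}^{1,T}$ ($T\ge1$ an integer): the set of programs given by integers $a,b,d\in[-T,T]$ with $a>0$, computing on $x\in\{0,1\}^n$ the value $$f(x)=\mathbf 1[\,a\cdot \mathrm{ps}(x)_n-b\cdot n-d>0\,].$$ (For $n=0$ use the same formula with $\mathrm{ps}(x)_0=0$.) $\text{C-RASP}^1=\bigcup_{T\ge1}\text{C-RASP}^{1,T}$. A program is encoded by a binary string encoding $(a,b,d)$; strings that are invalid encodings are mapped to a default program. The complexity of a program is $\max(|a|,|b|,|d|)$, and the complexity $\mathcal C(f)$ of a function $f:\{0,1\}^*\to\{0,1\}$ in the class is the minimum complexity of a program computing it. Training data: $D_N(f)=\{(x,f(x)):x\in\{0,1\}^*,|x|\le N\}$. The Minimum-Complexity Interpolator $\mathcal A_{\mathrm{mci}}$, given $D_N(f)$, outputs a program of minimum complexity in the class among all programs agreeing with all labels in $D_N(f)$ (ties broken by any fixed rule). Define $N_{\mathcal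 A_{\mathrm{mci}}}(f)=\min\{N\ge0:\forall n\ge N,\ \text{the program } \mathcal A_{\mathrm{mci}}(D_n(f)) \text{ computes } f \text{ on all of } \{0,1\}^*\}$ and $N_{\mathcal A_{\mathrm{mci}}}(T)=\max\{N_{\mathcal A_{\mathrm{mci}}}(f):f\in\mathcal F,\ \mathcal C(f)\le T\}$. *)

theory Defs
  imports Complex_Main "HOL-Library.Extended_Real"
begin

text \<open>Elements of \<open>{0,1}\<^sup>*\<close> are boolean lists, with \<open>True\<close> for 1. A program is the triple
  \<open>(a, b, d)\<close> of its parameters.\<close>

type_synonym program = "int \<times> int \<times> int"
type_synonym dataset = "(bool list \<times> bool) set"

definition ps :: "bool list \<Rightarrow> nat \<Rightarrow> int" where
  "ps x j = (\<Sum>l = 1..j. of_bool (x ! (l - 1)))"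

fun run :: "program \<Rightarrow> bool list \<Rightarrow> bool" where
  "run (a, b, d) x \<longleftrightarrow> a * ps x (length x) - b * int (length x) - d > 0"

definition C_RASP1_bounded :: "nat \<Rightarrow> program set" where
  "C_RASP1_bounded T =
     {(a, b, d). a \<in> {- int T..int T} \<and> b \<in> {- int T..int T} \<and> d \<in> {- int T..int T} \<and> a > 0}"

definition C_RASP1 :: "program set" where
  "C_RASP1 = (\<Union>T\<in>{1..}. C_RASP1_bounded T)"

definition C_RASP1_functions :: "(bool list \<Rightarrow> bool) set" where
  "C_RASP1_functions = run ` C_RASP1"

fun program_complexity :: "program \<Rightarrow> nat" where
  "program_complexity (a, b, d) = nat (max \<bar>a\<bar> (max \<bar>b\<bar> \<bar>d\<bar>))"

text \<open>Only meaningful for members of \<^const>\<open>C_RASP1_functions\<close>.\<close>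

definition fun_complexity :: "(bool list \<Rightarrow> bool) \<Rightarrow> nat" where
  "fun_complexity f = (LEAST k. \<exists>p\<in>C_RASP1. run p = f \<and> program_complexity p = k)"

definition training_data :: "nat \<Rightarrow> (bool list \<Rightarrow> bool) \<Rightarrow> dataset" where
  "training_data N f = {(x, f x) |x. length x \<le> N}"

definition agrees :: "program \<Rightarrow> dataset \<Rightarrow> bool" where
  "agrees p D \<longleftrightarrow> (\<forall>(x, y)\<in>D. run p x = y)"

text \<open>The tie-breaking rule is left open: any map from datasets to programs that always picks
  one of the simplest consistent programs qualifies. Nothing is required on datasets that are
  not of the form \<open>training_data N f\<close> with \<open>f\<close> in the class.\<close>

definition min_complexity_interpolator :: "(dataset \<Rightarrow> program) \<Rightarrow> bool" where
  "min_complexity_interpolator A \<longleftrightarrow>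
     (\<forall>f\<in>C_RASP1_functions. \<forall>N.
        is_arg_min program_complexity
          (\<lambda>p. p \<in> C_RASP1 \<and> agrees p (training_data N f))
          (A (training_data N f)))"

text \<open>The minimum and maximum are taken in \<^typ>\<open>enat\<close>, so that the value is \<open>\<infinity>\<close> when no
  sufficient length exists, respectively when the lengths are unbounded.\<close>

definition gen_length :: "(dataset \<Rightarrow> program) \<Rightarrow> (bool list \<Rightarrow> bool) \<Rightarrow> enat" where
  "gen_length A f = Inf {enat N |N. \<forall>n\<ge>N. run (A (training_data n f)) = f}"

definition worst_gen_length :: "(dataset \<Rightarrow> program) \<Rightarrow> nat \<Rightarrow> enat" where
  "worst_gen_length A T = Sup {gen_length A f |f. f \<in> C_RASP1_functions \<and> fun_complexity f \<le> T}"

end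

theory Submission
  imports Defs
begin

text \<open>Two programs \<open>(a, b, d)\<close> and \<open>(a', b', d')\<close> disagree on an input of length \<open>n\<close> with \<open>k\<close> ones
  iff, up to swapping them, \<open>(k, n)\<close> is an integer point of the polyhedron
  \<open>0 \<le> k \<le> n\<close>, \<open>a k - b n > d\<close>, \<open>a' k - b' n \<le> d'\<close>. By Cramer's rule its vertices have
  size \<open>O(T\<^sup>2)\<close>, and its recession cone has two extreme rays, spanned by integer vectors of size \<open>O(T)\<close>.
  From a point with \<open>n > 5 T\<^sup>2\<close> one of the two rays can be subtracted without leaving the polyhedron,
  so the programs already disagree on some input of length at most \<open>5 T\<^sup>2\<close>. Since the
  interpolator returns a program no more complex than the ground truth, it must then be correct.\<close>

section \<open>Lattice points where two programs disagree\<close>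

definition disagreement :: "program \<Rightarrow> program \<Rightarrow> int \<Rightarrow> int \<Rightarrow> bool" where
  "disagreement = (\<lambda>(a, b, d) (a', b', d') n k.
     0 \<le> k \<and> k \<le> n \<and> d < a * k - b * n \<and> a' * k - b' * n \<le> d')"

lemma disagreement_descent:
  fixes a b d a' b' d' n k T :: int
  assumes a: "0 < a" "a \<le> T" and b: "\<bar>b\<bar> \<le> T" and d: "\<bar>d\<bar> \<le> T"
    and a': "0 < a'" "a' \<le> T" and b': "\<bar>b'\<bar> \<le> T" and d': "\<bar>d'\<bar> \<le> T"
    and dis: "disagreement (a, b, d) (a', b', d') n k"
    and n: "5 * T\<^sup>2 < n"
  shows "\<exists>m j. m < n \<and> disagreement (a, b, d) (a', b', d') m j"
proof -
  have k: "0 \<le> k" "k \<le> n" and L1: "d + 1 \<le> a * k - b * n" and L2: "a' * k - b' * n \<le> d'"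
    using dis by (auto simp: disagreement_def)
  define S where "S = T * T"
  have T: "1 \<le> T" using a by linarith
  then have "T \<le> S" by (simp add: S_def mult_le_cancel_left1)
  \<comment> \<open>Source of the constant 5: \<open>2 * S\<close> bounds the cross terms of
    \<open>d\<close> and \<open>d'\<close>, multiples of \<open>T\<close> absorb the ray lengths
    \<open>a\<close>, \<open>a'\<close> and single offsets, and \<open>T \<le> S\<close>.\<close>
  then have nT: "5 * T < n" "2 * S + 3 * T < n"
    using n by (auto simp: power2_eq_square simp flip: S_def)
  have "\<bar>a' * d\<bar> \<le> S" "\<bar>a * d'\<bar> \<le> S"
    unfolding abs_mult S_def using a a' d d' by (auto intro!: mult_mono)
  then have prod_d: "a' * d - a * d' \<le> 2 * S" "a * d' - a' * d \<le> 2 * S" by auto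
  \<comment> \<open>This is \<open>a * a'\<close> times the gap \<open>b' / a' - b / a\<close>
    between the two slopes.\<close>
  define \<Delta> where "\<Delta> = a * b' - a' * b"
  \<comment> \<open>Integrality: a positive \<open>x\<close> is at least 1. This turns inequalities
    at one far point into signs of coefficients.\<close>
  have lin: "x \<le> 0" if "x * m \<le> c" "c < m" "0 \<le> m" for x m c :: int
  proof (rule ccontr)
    assume "\<not> x \<le> 0"
    then have "m \<le> x * m" using that(3) by (simp add: mult_le_cancel_right1)
    then show False using that by linarith
  qed
  \<comment> \<open>A point this far out forces a nonzero recession direction: the lower slopes
    \<open>b / a\<close> and 0 cannot exceed the upper slopes \<open>b' / a'\<close> and 1.\<close>
  have \<Delta>: "0 \<le> \<Delta>"
  proof -
    have "a' * (d + 1) \<le> a' * (a * k - b * n)" "a * (a' * k - b' * n) \<le> a * d'"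
      using a a' L1 L2 by (auto intro: mult_left_mono)
    then have "(- \<Delta>) * n \<le> a * d' - a' * d - a'"
      unfolding \<Delta>_def by (simp add: algebra_simps)
    then have "(- \<Delta>) * n \<le> 2 * S" using prod_d a' by linarith
    from lin[OF this] show ?thesis using nT T k by linarith
  qed
  have ba: "b \<le> a"
  proof -
    have "a * k \<le> a * n" using a k by simp
    then have "(b - a) * n \<le> - d - 1" using L1 by (simp add: algebra_simps)
    from lin[OF this] show ?thesis using d nT T k by linarith
  qed
  have b'0: "0 \<le> b'"
  proof -
    have "0 \<le> a' * k" using a' k by simp
    then have "(- b') * n \<le> d'" using L2 by (simp add: algebra_simps)
    from lin[OF this] show ?thesis using d' nT T k by linarith
  qed
  \<comment> \<open>The lower and upper extreme rays of the recession cone are \<open>(l, a)\<close> and \<open>(u, a')\<close>.\<close>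
  define l where "l = max b 0"
  define u where "u = min b' a'"
  have l: "0 \<le> l" "b \<le> l" "l \<le> a" using ba a by (auto simp: l_def)
  have u: "0 \<le> u" "u \<le> b'" "u \<le> a'" using b'0 a' by (auto simp: u_def)
  \<comment> \<open>Subtracting \<open>(l, a)\<close> raises \<open>a' * k - b' * n\<close> by the
    first quantity; subtracting \<open>(u, a')\<close> lowers \<open>a * k - b * n\<close> by the
    second.\<close>
  have l\<Delta>: "a * b' - a' * l \<le> \<Delta>" and u\<Delta>: "a * u - a' * b \<le> \<Delta>"
    using l u a a' by (auto simp: \<Delta>_def)
  \<comment> \<open>A lower bound on \<open>k\<close> whose boundary is parallel to the ray keeps
    its margin; one that is not parallel is slack because \<open>n\<close> is large.\<close>
  have lower: "d < a * (k - l) - b * (n - a)" "0 \<le> k - l"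
  proof -
    show "d < a * (k - l) - b * (n - a)"
    proof (cases "0 \<le> b")
      case True
      then show ?thesis using L1 by (simp add: l_def algebra_simps)
    next
      case False
      then have "1 * (n - a) \<le> (- b) * (n - a)" using a nT T by (intro mult_right_mono) auto
      moreover have "0 \<le> a * k" using a k by simp
      moreover have "l = 0" using False by (simp add: l_def)
      ultimately show ?thesis using nT a d T by simp
    qed
    show "0 \<le> k - l"
    proof (cases "0 < b")
      case True
      then have "1 * (n - a) \<le> b * (n - a)" using a nT T by (intro mult_right_mono) auto
      then have "n - a \<le> b * n - a * b" by (simp add: algebra_simps)
      then have "a * b < a * k" using L1 nT a d T by linarith
      then show ?thesis using a True by (simp add: l_def)
    qed (use k in \<open>simp add: l_def\<close>)
  qed
  \<comment> \<open>The mirror image for the upper bounds on \<open>k\<close>, under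
    \<open>k\<close> to \<open>n - k\<close>.\<close>
  have upper: "a' * (k - u) - b' * (n - a') \<le> d'" "k - u \<le> n - a'"
  proof -
    show "a' * (k - u) - b' * (n - a') \<le> d'"
    proof (cases "b' \<le> a'")
      case True
      then show ?thesis using L2 by (simp add: u_def algebra_simps)
    next
      case False
      have "a' * (k - u) - b' * (n - a') = a' * (k - n) - (b' - a') * (n - a')"
        using False by (simp add: u_def algebra_simps)
      also have "\<dots> \<le> a' * 0 - 1 * (n - a')"
        using False a' k nT T by (intro diff_mono mult_left_mono mult_right_mono) auto
      also have "\<dots> \<le> d'" using nT a' d' T by simp
      finally show ?thesis .
    qed
    show "k - u \<le> n - a'"
    proof (cases "b' < a'")
      case True
      then have "1 * (n - a') \<le> (a' - b') * (n - a')" using a' nT T by (intro mult_right_mono) auto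
      then have "n - a' \<le> a' * n - a' * a' - b' * n + a' * b'" by (simp add: algebra_simps)
      then have "a' * k - a' * b' \<le> a' * n - a' * a'" using L2 nT a' d' T by linarith
      then have "a' * (k - b') \<le> a' * (n - a')" by (simp only: right_diff_distrib)
      then show ?thesis using a' True by (simp add: u_def)
    qed (use k in \<open>simp add: u_def\<close>)
  qed
  \<comment> \<open>If neither ray can be subtracted, then a constraint that bounds the slope from above and
    one that bounds it from below are both almost tight, so the point is near a vertex.\<close>
  have "(a' * (k - l) - b' * (n - a) \<le> d' \<and> k - l \<le> n - a) \<or>
        (d < a * (k - u) - b * (n - a') \<and> 0 \<le> k - u)"
  proof (rule ccontr)
    assume "\<not> ?thesis"
    \<comment> \<open>Labels: the constraint broken by the lower ray, then the one broken by the
      upper ray, with 1 and 2 for the two programs, 3 for \<open>0 \<le> k\<close> and 4 for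
      \<open>k \<le> n\<close>.\<close>
    then consider
        (21) "d' < a' * (k - l) - b' * (n - a)" "a * (k - u) - b * (n - a') \<le> d"
      | (41) "n - a < k - l" "a * (k - u) - b * (n - a') \<le> d"
      | (23) "d' < a' * (k - l) - b' * (n - a)" "k < u"
      | (43) "n - a < k - l" "k < u"
      by linarith
    then show False
    proof cases
      case 21
      \<comment> \<open>Cramer's rule with errors: eliminating \<open>k\<close> bounds
        \<open>\<Delta> * n\<close> by \<open>2 * S + (a + a') * \<Delta>\<close>, where
        \<open>\<Delta>\<close> is a positive integer.\<close>
      have "0 < \<Delta>" using 21 L2 l\<Delta> by (simp add: algebra_simps)
      have "a * d' \<le> a * (a' * (k - l) - b' * (n - a))" "a' * (a * (k - u) - b * (n - a')) \<le> a' * d"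
        using 21 a a' by (auto intro: mult_left_mono)
      then have "\<Delta> * n \<le> a' * d - a * d' + a * (a * b' - a' * l) + a' * (a * u - a' * b)"
        unfolding \<Delta>_def by (simp add: algebra_simps)
      also have "\<dots> \<le> a' * d - a * d' + a * \<Delta> + a' * \<Delta>"
        using l\<Delta> u\<Delta> a a' by (intro add_mono mult_left_mono) auto
      finally have "\<Delta> * (n - a - a') \<le> a' * d - a * d'" by (simp add: algebra_simps)
      then have *: "\<Delta> * (n - a - a') \<le> 2 * S" using prod_d by linarith
      from lin[OF *] show False using \<open>0 < \<Delta>\<close> nT a a' by linarith
    next
      case 41
      \<comment> \<open>The same elimination against \<open>k \<le> n\<close>, with
        \<open>a - b\<close> in place of \<open>\<Delta>\<close>; in the next case it is
        \<open>b'\<close>, against \<open>0 \<le> k\<close>.\<close>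
      have "b < a" using 41 k l by linarith
      have "a * (n - a + l) \<le> a * k" using 41 a by (intro mult_left_mono) auto
      then have "(a - b) * n \<le> d + a * (a - l) + (a * u - a' * b)"
        using 41 by (simp add: algebra_simps)
      also have "\<dots> \<le> d + a * (a - b) + (a * a' - a' * b)"
        using l u a by (intro add_mono diff_mono mult_left_mono) auto
      finally have *: "(a - b) * (n - a - a') \<le> d" by (simp add: algebra_simps)
      from lin[OF *] show False using \<open>b < a\<close> nT a a' d T by linarith
    next
      case 23
      have "0 < b'" using 23 k u by linarith
      have "a' * k \<le> a' * b'" "0 \<le> a' * l" using 23 u a' l by auto
      then have *: "b' * (n - a - a') \<le> - d'" using 23 by (simp add: algebra_simps)
      from lin[OF *] show False using \<open>0 < b'\<close> nT a a' d' T by linarith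
    next
      case 43
      then show False using l u a a' nT T by linarith
    qed
  qed
  then show ?thesis
  proof
    assume "a' * (k - l) - b' * (n - a) \<le> d' \<and> k - l \<le> n - a"
    then have "disagreement (a, b, d) (a', b', d') (n - a) (k - l)"
      using lower by (simp add: disagreement_def)
    moreover have "n - a < n" using a by simp
    ultimately show ?thesis by blast
  next
    assume "d < a * (k - u) - b * (n - a') \<and> 0 \<le> k - u"
    then have "disagreement (a, b, d) (a', b', d') (n - a') (k - u)"
      using upper by (simp add: disagreement_def)
    moreover have "n - a' < n" using a' by simp
    ultimately show ?thesis by blast
  qed
qed

lemma C_RASP1_bounds:
  assumes "(a, b, d) \<in> C_RASP1" "program_complexity (a, b, d) \<le> T"
  shows "0 < a" "a \<le> int T" "\<bar>b\<bar> \<le> int T" "\<bar>d\<bar> \<le> int T"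
  using assms by (auto simp: C_RASP1_def C_RASP1_bounded_def)

text \<open>The descent terminates since \<open>0 \<le> k \<le> n\<close> keeps every
  \<open>n\<close> nonnegative.\<close>

lemma short_disagreement:
  assumes "p \<in> C_RASP1" "program_complexity p \<le> T" "q \<in> C_RASP1" "program_complexity q \<le> T"
    and "disagreement p q n k"
  shows "\<exists>m j. m \<le> 5 * (int T)\<^sup>2 \<and> disagreement p q m j"
  using assms(5)
proof (induction "nat n" arbitrary: n k rule: less_induct)
  case less
  obtain a b d a' b' d' where pq: "p = (a, b, d)" "q = (a', b', d')" by (metis prod_cases3)
  show ?case
  proof (cases "n \<le> 5 * (int T)\<^sup>2")
    case False
    have "0 < a" "a \<le> int T" "\<bar>b\<bar> \<le> int T" "\<bar>d\<bar> \<le> int T"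
      using C_RASP1_bounds assms(1,2) unfolding pq by blast+
    moreover have "0 < a'" "a' \<le> int T" "\<bar>b'\<bar> \<le> int T" "\<bar>d'\<bar> \<le> int T"
      using C_RASP1_bounds assms(3,4) unfolding pq by blast+
    ultimately obtain m j where m: "m < n" "disagreement p q m j"
      using disagreement_descent less.prems False unfolding pq not_le by blast
    moreover have "nat m < nat n" using m by (auto simp: disagreement_def pq)
    ultimately show ?thesis using less.hyps by blast
  qed (use less.prems in blast)
qed

section \<open>Inputs as lattice points\<close>

lemma ps_length_bounds: "0 \<le> ps x (length x)" "ps x (length x) \<le> int (length x)"
proof -
  show "0 \<le> ps x (length x)" by (simp add: ps_def sum_nonneg)
  have "ps x (length x) \<le> (\<Sum>l = 1..length x. 1)"
    unfolding ps_def by (intro sum_mono) auto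
  then show "ps x (length x) \<le> int (length x)" by simp
qed

lemma ps_replicate:
  assumes "k \<le> n"
  shows "ps (replicate k True @ replicate (n - k) False) n = int k"
proof -
  have "ps (replicate k True @ replicate (n - k) False) n = (\<Sum>l = 1..n. of_bool (l \<in> {1..k}))"
    unfolding ps_def using assms by (intro sum.cong) (auto simp: nth_append)
  also have "\<dots> = int (card ({1..n} \<inter> {1..k}))" by (subst sum_of_bool_eq) (simp_all only: finite_atLeastAtMost Collect_mem_eq)
  also have "\<dots> = int k" using assms by (simp add: Int_absorb1)
  finally show ?thesis .
qed

lemma disagreement_of_run:
  assumes "run p x" "\<not> run q x"
  shows "disagreement p q (int (length x)) (ps x (length x))"
  using assms ps_length_bounds[of x] by (cases p; cases q) (auto simp: disagreement_def)

text \<open>\<open>run\<close> depends on an input only through its length and its number of ones,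
  so a word with all ones first realises the pair.\<close>

lemma run_of_disagreement:
  assumes "disagreement p q n k"
  shows "\<exists>x. int (length x) = n \<and> run p x \<and> \<not> run q x"
proof -
  have k: "0 \<le> k" "k \<le> n" using assms by (auto simp: disagreement_def split: prod.splits)
  let ?x = "replicate (nat k) True @ replicate (nat n - nat k) False"
  have "length ?x = nat n" "ps ?x (nat n) = k"
    using k ps_replicate[of "nat k" "nat n"] by auto
  then show ?thesis
    using assms k
    by (intro exI[of _ ?x], cases p; cases q) (auto simp: disagreement_def simp del: length_append)
qed

lemma run_eq_if_agree_short:
  assumes "p \<in> C_RASP1" "program_complexity p \<le> T" "q \<in> C_RASP1" "program_complexity q \<le> T"
    and agree: "\<And>x. length x \<le> 5 * T\<^sup>2 \<Longrightarrow> run p x = run q x"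
  shows "run p = run q"
proof -
  \<comment> \<open>\<open>disagreement\<close> is one-sided, so both orders of \<open>p\<close> and
    \<open>q\<close> are treated at once.\<close>
  have imp: "run q' x"
    if "p' \<in> {p, q}" "q' \<in> {p, q}" "run p' x" for p' q' x
  proof (rule ccontr)
    assume "\<not> run q' x"
    then have "disagreement p' q' (int (length x)) (ps x (length x))"
      using that by (intro disagreement_of_run)
    moreover have "p' \<in> C_RASP1" "program_complexity p' \<le> T" "q' \<in> C_RASP1" "program_complexity q' \<le> T"
      using that assms(1-4) by auto
    ultimately obtain m j where m: "m \<le> 5 * (int T)\<^sup>2" "disagreement p' q' m j"
      using short_disagreement by blast
    then obtain y where y: "int (length y) = m" "run p' y" "\<not> run q' y"
      using run_of_disagreement by blast
    have "int (length y) \<le> int (5 * T\<^sup>2)" using m y by simp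
    then have "length y \<le> 5 * T\<^sup>2" by (simp only: of_nat_le_iff)
    then show False using agree y that by blast
  qed
  then show ?thesis by (intro ext) blast
qed

section \<open>The interpolator and its sample length\<close>

lemma fun_complexity_attained:
  assumes "f \<in> C_RASP1_functions"
  obtains p where "p \<in> C_RASP1" "run p = f" "program_complexity p = fun_complexity f"
proof -
  have "\<exists>k. \<exists>p\<in>C_RASP1. run p = f \<and> program_complexity p = k"
    using assms by (auto simp: C_RASP1_functions_def)
  from LeastI_ex[OF this] show ?thesis using that unfolding fun_complexity_def by blast
qed

lemma interpolator_correct:
  assumes A: "min_complexity_interpolator A" and f: "f \<in> C_RASP1_functions" "fun_complexity f \<le> T"
    and n: "5 * T\<^sup>2 \<le> n"
  shows "run (A (training_data n f)) = f"
proof -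
  obtain p where p: "p \<in> C_RASP1" "run p = f" "program_complexity p \<le> T"
    using fun_complexity_attained f by metis
  let ?q = "A (training_data n f)"
  have arg_min: "is_arg_min program_complexity
      (\<lambda>p. p \<in> C_RASP1 \<and> agrees p (training_data n f)) ?q"
    using A f unfolding min_complexity_interpolator_def by blast
  \<comment> \<open>A simplest program for \<open>f\<close> is itself a candidate, so the output
    cannot exceed its complexity, whatever the tie-breaking.\<close>
  have "agrees p (training_data n f)" using p by (auto simp: agrees_def training_data_def)
  then have "\<not> program_complexity p < program_complexity ?q"
    using arg_min p(1) unfolding is_arg_min_def by blast
  then have "program_complexity ?q \<le> T" using p(3) by linarith
  moreover have "?q \<in> C_RASP1" and q: "agrees ?q (training_data n f)"
    using arg_min by (auto simp: is_arg_min_def)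
  moreover have "run ?q x = run p x" if "length x \<le> 5 * T\<^sup>2" for x
    using q p n that by (auto simp: agrees_def training_data_def)
  ultimately show ?thesis using run_eq_if_agree_short p by metis
qed

theorem theorem5p5:
  shows "\<exists>C\<^sub>0::real. C\<^sub>0 > 0 \<and>
    (\<forall>A. min_complexity_interpolator A \<longrightarrow>
      (\<forall>T::nat. T \<ge> 1 \<longrightarrow>
        ereal_of_enat (worst_gen_length A T) \<le> ereal (C\<^sub>0 * (real T)\<^sup>2)))"
proof (intro exI[of _ 5] conjI allI impI)
  fix A and T :: nat
  assume A: "min_complexity_interpolator A"
  \<comment> \<open>\<open>gen_length\<close> is an infimum, so one threshold from which all
    \<open>n\<close> succeed is enough.\<close>
  have "gen_length A f \<le> enat (5 * T\<^sup>2)" if "f \<in> C_RASP1_functions" "fun_complexity f \<le> T" for f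
    unfolding gen_length_def using interpolator_correct[OF A that] by (intro Inf_lower) blast
  then have "worst_gen_length A T \<le> enat (5 * T\<^sup>2)"
    unfolding worst_gen_length_def by (intro Sup_least) blast
  then have "ereal_of_enat (worst_gen_length A T) \<le> ereal_of_enat (enat (5 * T\<^sup>2))"
    by (simp only: ereal_of_enat_le_iff)
  then show "ereal_of_enat (worst_gen_length A T) \<le> ereal (5 * (real T)\<^sup>2)" by simp
qed simp

end
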